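(* The critical surface consists of two surfaces $S^{+}$ and $S^{-}$ (defined in the context), and $S^{\pm}$ is the image of $[-1,1]\times[0,2\pi]$ in $D^{\pm}$ under the map $$\phi^{\pm}:[-1,1]\times[0,2\pi]\to S^{\pm},\qquad (s,t)\mapsto(\nu_1,\nu_2,\nu_4)=\left(\tfrac12\sqrt2\,s\cos t,\ \tfrac12\sqrt2\,\cos t,\ s\sin t\right).$$ With $t=0$ and $t=2\pi$ identified (note $\phi^\pm(s,0)=\phi^\pm(s,2\pi)$), the map $\phi^{\pm}$ is one-to-one except for $$\phi^{\pm}\left(s,\tfrac{\pi}{2}\right)=\phi^{\pm}\left(-s,\tfrac{3\pi}{2}\right)\ \text{ for } s\in[-1,1],\qquad \phi^{\pm}(0,t)=\phi^{\pm}(0,2\pi-t)\ \text{ for } t\in[0,2\pi],$$ where $\phi^{\pm}$ is two-to-one (apart from the points $(0,0)\sim(0,2\pi)$ and $(0,\pi)$, at which the two listed preimages coincide).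
   Context: The unit $3$-sphere $\{\nu\in\mathbb{R}^4:\|\nu\|=1\}$ is the union of the two closed $3$-discs $D^{\pm}=\{\nu : \nu_1^2+\nu_2^2+\nu_4^2\le1,\ \nu_3=\pm\sqrt{1-(\nu_1^2+\nu_2^2+\nu_4^2)}\}$, glued along $\nu_3=0$; points of $D^{\pm}$ are described by the coordinates $(\nu_1,\nu_2,\nu_4)$. Let $G(\nu)=\nu_1^2-2\nu_1^2\nu_2^2-\nu_2^2\nu_4^2$ (which on the unit sphere equals $(\nu_1^2-\nu_2^2)(\nu_1^2+\nu_4^2)+\nu_1^2\nu_3^2$). The surfaces $S^{\pm}$ are the $2$-dimensional parts of $\{\nu\in D^{\pm} : G(\nu)=0\}$, i.e. the set of points of this semi-algebraic set at which its local dimension is $2$; the critical surface is $S=S^+\cup S^-$. *)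

theory Defs
  imports "HOL-Analysis.Analysis"
begin

text \<open>
  Dimension of a semi-algebraic set: the largest \<open>d\<close> such that the set contains an open
  \<open>d\<close>-cell, i.e. a homeomorphic copy of the open \<open>d\<close>-cube (equivalently of d-dimensional Euclidean space).
  On semi-algebraic sets this agrees with the dimension read off from a decomposition
  into semi-algebraic cells, by invariance of domain.  The value is only meaningful for nonempty sets.
\<close>

definition contains_cell :: "'a::euclidean_space set \<Rightarrow> nat \<Rightarrow> bool" where
  "contains_cell A d \<longleftrightarrow> (\<exists>B\<subseteq>A. top_of_set B homeomorphic_space Euclidean_space d)"

definition cell_dim :: "'a::euclidean_space set \<Rightarrow> nat" where
  "cell_dim A = (GREATEST d. contains_cell A d)"

text \<open>
  Local dimension of \<open>A\<close> at \<open>x \<in> A\<close>: the dimension of \<open>A \<inter> U\<close> for all small enough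
  neighbourhoods \<open>U\<close> of \<open>x\<close>.  As \<open>cell_dim\<close> is monotone, this is the least value attained.
\<close>

definition local_dim :: "'a::euclidean_space set \<Rightarrow> 'a \<Rightarrow> nat" where
  "local_dim A x = (INF U\<in>{U. open U \<and> x \<in> U}. cell_dim (A \<inter> U))"

text \<open>The sign \<open>\<plusminus>\<close> is a real parameter \<open>\<sigma>\<close>, to be taken in \<open>{1, -1}\<close>.\<close>

definition disc :: "real \<Rightarrow> (real^4) set" where
  "disc \<sigma> = {\<nu>. (\<nu>$1)\<^sup>2 + (\<nu>$2)\<^sup>2 + (\<nu>$4)\<^sup>2 \<le> 1 \<and>
                \<nu>$3 = \<sigma> * sqrt (1 - ((\<nu>$1)\<^sup>2 + (\<nu>$2)\<^sup>2 + (\<nu>$4)\<^sup>2))}"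

definition disc_point :: "real \<Rightarrow> real \<Rightarrow> real \<Rightarrow> real \<Rightarrow> real^4" where
  "disc_point \<sigma> a b c = vector [a, b, \<sigma> * sqrt (1 - (a\<^sup>2 + b\<^sup>2 + c\<^sup>2)), c]"

definition G :: "real^4 \<Rightarrow> real" where
  "G \<nu> = (\<nu>$1)\<^sup>2 - 2 * (\<nu>$1)\<^sup>2 * (\<nu>$2)\<^sup>2 - (\<nu>$2)\<^sup>2 * (\<nu>$4)\<^sup>2"

definition zero_locus :: "real \<Rightarrow> (real^4) set" where
  "zero_locus \<sigma> = {\<nu> \<in> disc \<sigma>. G \<nu> = 0}"

definition surface :: "real \<Rightarrow> (real^4) set" where
  "surface \<sigma> = {\<nu> \<in> zero_locus \<sigma>. local_dim (zero_locus \<sigma>) \<nu> = 2}"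

definition critical_surface :: "(real^4) set" where
  "critical_surface = surface 1 \<union> surface (-1)"

definition phi :: "real \<Rightarrow> real \<times> real \<Rightarrow> real^4" where
  "phi \<sigma> = (\<lambda>(s, t). disc_point \<sigma> (1/2 * sqrt 2 * s * cos t) (1/2 * sqrt 2 * cos t) (s * sin t))"

definition rectangle :: "(real \<times> real) set" where
  "rectangle = {-1..1} \<times> {0..2*pi}"

text \<open>The equivalence relation on the rectangle identifying \<open>t = 0\<close> with \<open>t = 2\<pi>\<close>.\<close>

definition glue :: "((real \<times> real) \<times> (real \<times> real)) set" where
  "glue = {((s, t), (s', t')). (s, t) \<in> rectangle \<and> (s', t') \<in> rectangle \<and>
             s = s' \<and> (t = t' \<or> {t, t'} = {0, 2*pi})}"

abbreviation cls :: "real \<times> real \<Rightarrow> (real \<times> real) set" where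
  "cls p \<equiv> glue `` {p}"

text \<open>The fibre over \<open>\<nu>\<close> of the map induced by \<open>phi \<sigma>\<close> on the glued rectangle.\<close>

definition fibre :: "real \<Rightarrow> real^4 \<Rightarrow> (real \<times> real) set set" where
  "fibre \<sigma> \<nu> = {c \<in> rectangle // glue. phi \<sigma> ` c = {\<nu>}}"

end

theory Submission
  imports Defs
begin

text \<open>
  Write \<open>(a, b, c)\<close> for the disc coordinates \<open>(\<nu>\<^sub>1, \<nu>\<^sub>2, \<nu>\<^sub>4)\<close>. The equation
  \<open>G \<nu> = 0\<close> reads \<open>a\<^sup>2 (1 - 2 b\<^sup>2) = b\<^sup>2 c\<^sup>2\<close>, so the sign of \<open>1 - 2 b\<^sup>2\<close> decides everything.
  If \<open>2 b\<^sup>2 \<le> 1\<close>, put \<open>b = cos t / sqrt 2\<close>; then \<open>1 - 2 b\<^sup>2 = sin\<^sup>2 t\<close>, the equation becomes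
  \<open>a sin t = \<plusminus> b c\<close>, and replacing \<open>t\<close> by \<open>2 \<pi> - t\<close> absorbs the sign. So \<open>(a, c)\<close> is
  proportional to \<open>(b, sin t)\<close>, the factor being \<open>s\<close>, and on this part of the surface the
  norm condition says exactly \<open>\<bar>s\<bar> \<le> 1\<close>: this part is the image of \<open>phi\<close> (lemma
  \<open>phi_image_eq\<close>). If \<open>2 b\<^sup>2 > 1\<close>, both sides of the equation vanish, so \<open>a = c = 0\<close>: what remains
  is a pair of whiskers on the \<open>b\<close>-axis (lemma \<open>zero_locus_whisker\<close>).

  It remains to see that the local dimension is 2 on the first part and smaller on the whiskers.
  Upper bounds come from invariance of domain: a set that injects continuously into a space of
  dimension \<open>n\<close>, with an image that has no interior points, contains no \<open>n\<close>-cell (lemma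
  \<open>contains_cell_less_DIM\<close>). This is used with \<open>n = 3\<close> for the zero locus and with \<open>n = 2\<close> for the
  whiskers. The lower bound holds because \<open>phi\<close> is injective on an open dense subset of the
  rectangle, so every neighbourhood of a point of the image contains the image of a small disc
  (lemma \<open>phi_image_contains_2_cell\<close>). Density makes this work at every point of the
  image, including boundary points and points of self-intersection.

  The fibres are a computation: the second coordinate determines \<open>t\<close> up to \<open>t \<mapsto> 2 \<pi> - t\<close>, and
  then \<open>s cos t\<close> and \<open>s sin t\<close> determine the rest (lemma \<open>phi_eq_imp\<close>).
\<close>

section \<open>Cells and local dimension\<close>

lemma euclidean_homeomorphic_Euclidean_space:
  "(euclidean :: 'c::euclidean_space topology) homeomorphic_space Euclidean_space DIM('c)"
proof -
  obtain \<beta> where \<beta>: "bij_betw \<beta> {..<DIM('c)} (Basis :: 'c set)"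
    using ex_bij_betw_nat_finite[of "Basis :: 'c set"] by (auto simp: lessThan_atLeast0)
  define f where "f = (\<lambda>x::'c. \<lambda>i. if i < DIM('c) then x \<bullet> \<beta> i else 0)"
  define g where "g = (\<lambda>y. \<Sum>i<DIM('c). y i *\<^sub>R \<beta> i)"
  have gsum: "g y = (\<Sum>b\<in>Basis. y (the_inv_into {..<DIM('c)} \<beta> b) *\<^sub>R b)" for y
    unfolding g_def sum.reindex_bij_betw[OF \<beta>, symmetric]
    using \<beta> by (intro sum.cong) (auto simp: the_inv_into_f_f bij_betw_def)
  have basis: "\<beta> i \<in> Basis" if "i < DIM('c)" for i
    using \<beta> that by (auto simp: bij_betw_def)
  have "homeomorphic_maps euclidean (Euclidean_space DIM('c)) f g"
    unfolding homeomorphic_maps_def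
  proof (intro conjI ballI)
    show "continuous_map euclidean (Euclidean_space DIM('c)) f"
      unfolding f_def
      by (simp add: continuous_map_componentwise_Euclidean_space continuous_intros)
    show "continuous_map (Euclidean_space DIM('c)) euclidean g"
      unfolding g_def continuous_map_Euclidean_space_iff
      by (intro continuous_intros continuous_on_subset[OF continuous_on_product_coordinates] subset_UNIV)
    show "g (f x) = x" for x
    proof -
      have "g (f x) = (\<Sum>i<DIM('c). (x \<bullet> \<beta> i) *\<^sub>R \<beta> i)"
        unfolding g_def f_def by simp
      also have "\<dots> = (\<Sum>b\<in>Basis. (x \<bullet> b) *\<^sub>R b)"
        by (rule sum.reindex_bij_betw[OF \<beta>])
      finally show ?thesis by (simp add: euclidean_representation)
    qed
    show "f (g y) = y" if "y \<in> topspace (Euclidean_space DIM('c))" for y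
    proof
      fix i
      have "g y \<bullet> \<beta> i = y i" if "i < DIM('c)"
        using basis[OF that] \<beta> that
        by (simp add: gsum inner_sum_left_Basis the_inv_into_f_f bij_betw_def)
      then show "f (g y) i = y i"
        using \<open>y \<in> _\<close> by (simp add: f_def topspace_Euclidean_space)
    qed
  qed
  then show ?thesis
    by (rule homeomorphic_maps_imp_homeomorphic_space)
qed

text \<open>
  Replaces the abstract model of Euclidean space on sequences by a Euclidean type, where invariance
  of domain is available.
\<close>

lemma contains_cell_DIM_iff:
  "contains_cell A DIM('c::euclidean_space) \<longleftrightarrow> (\<exists>B\<subseteq>A. B homeomorphic (UNIV :: 'c set))"
proof -
  note hom = euclidean_homeomorphic_Euclidean_space[where 'c='c]
  have "top_of_set B homeomorphic_space Euclidean_space DIM('c) \<longleftrightarrow>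
        top_of_set B homeomorphic_space (euclidean :: 'c topology)" for B :: "'a set"
    using hom homeomorphic_space_sym[THEN iffD1, OF hom] by (meson homeomorphic_space_trans)
  moreover have "top_of_set B homeomorphic_space (euclidean :: 'c topology) \<longleftrightarrow>
      B homeomorphic (UNIV :: 'c set)" for B :: "'a set"
  proof -
    have "homeomorphic_maps (top_of_set B) (euclidean :: 'c topology) f g \<longleftrightarrow>
          homeomorphism B UNIV f g" for f g
    proof
      assume "homeomorphic_maps (top_of_set B) (euclidean :: 'c topology) f g"
      then have fg: "continuous_on B f" "continuous_on UNIV g" "range g \<subseteq> B"
        "\<forall>x\<in>B. g (f x) = x" "\<forall>y. f (g y) = y"
        by (auto simp: homeomorphic_maps_def continuous_map_in_subtopology)
      show "homeomorphism B UNIV f g"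
        using fg by (intro homeomorphismI) auto
    next
      assume "homeomorphism B UNIV f g"
      then show "homeomorphic_maps (top_of_set B) (euclidean :: 'c topology) f g"
        by (auto simp: homeomorphic_maps_def continuous_map_in_subtopology homeomorphism_def)
    qed
    then show ?thesis
      by (simp add: homeomorphic_space_def homeomorphic_def)
  qed
  ultimately show ?thesis
    unfolding contains_cell_def by simp
qed

lemma contains_cell_0: "contains_cell A 0" if "x \<in> A"
proof -
  have "homeomorphic_maps (top_of_set {x}) (Euclidean_space 0) (\<lambda>_ _. 0) (\<lambda>_. x)"
    by (auto simp: homeomorphic_maps_def topspace_Euclidean_space)
  with that show ?thesis
    unfolding contains_cell_def
    using homeomorphic_maps_imp_homeomorphic_space by blast
qed

lemma contains_cell_lower_dim:
  assumes "contains_cell A d" "e \<le> d"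
  shows "contains_cell A e"
proof -
  obtain B f where B: "B \<subseteq> A" and f: "homeomorphic_map (Euclidean_space d) (top_of_set B) f"
    using assms(1) unfolding contains_cell_def
    by (metis homeomorphic_space homeomorphic_space_sym)
  define E :: "(nat \<Rightarrow> real) set" where "E = topspace (Euclidean_space e)"
  have sub: "E \<subseteq> topspace (Euclidean_space d)"
    using assms(2) by (simp add: E_def)
  have "homeomorphic_map (subtopology (Euclidean_space d) E) (subtopology (top_of_set B) (f ` E)) f"
    using f sub
    using homeomorphic_imp_surjective_map[OF f]
    by (intro homeomorphic_map_subtopologies) auto
  moreover have "subtopology (Euclidean_space d) E = Euclidean_space e"
    using sub unfolding E_def
    by (auto simp: Euclidean_space_def subtopology_subtopology Int_absorb1)
  moreover have "f ` E \<subseteq> B"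
    using homeomorphic_imp_surjective_map[OF f] sub by auto
  ultimately have "Euclidean_space e homeomorphic_space top_of_set (f ` E)"
    by (metis homeomorphic_map_imp_homeomorphic_space inf.absorb2 subtopology_subtopology)
  with B \<open>f ` E \<subseteq> B\<close> show ?thesis
    unfolding contains_cell_def using homeomorphic_space_sym by blast
qed

text \<open>
  A cell of dimension \<open>DIM('b)\<close> or more would contain a copy of the whole space \<open>'b\<close>. Composing its
  parametrisation with \<open>g\<close> gives a continuous injection of \<open>'b\<close> into itself, whose image is open by
  invariance of domain; but it lies inside a set without interior.
\<close>

lemma contains_cell_less_DIM:
  fixes g :: "'a::euclidean_space \<Rightarrow> 'b::euclidean_space"
  assumes "contains_cell A d" "continuous_on A g" "inj_on g A" "interior (g ` A) = {}"
  shows "d < DIM('b)"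
proof (rule ccontr)
  assume "\<not> d < DIM('b)"
  then have "contains_cell A DIM('b)"
    using assms(1) contains_cell_lower_dim by force
  then obtain B h k where B: "B \<subseteq> A" and hom: "homeomorphism (UNIV :: 'b set) B h k"
    unfolding contains_cell_DIM_iff by (meson homeomorphic_def homeomorphic_sym)
  have "open ((g \<circ> h) ` UNIV)"
  proof (rule invariance_of_domain)
    show "continuous_on UNIV (g \<circ> h)"
      using hom B assms(2)
      by (metis continuous_on_compose continuous_on_subset homeomorphism_def)
    show "inj (g \<circ> h)"
      using hom B assms(3)
      by (metis comp_inj_on homeomorphism_def inj_on_inverseI inj_on_subset)
  qed auto
  moreover have "(g \<circ> h) ` UNIV \<subseteq> g ` A"
    using hom B by (auto simp: homeomorphism_def)
  ultimately show False
    using assms(4) interior_maximal by blast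
qed

text \<open>
  The previous bound, applied to the inclusion into the hyperplane \<open>'a \<times> {0}\<close>, which has no interior.
  This bound makes the maximum that defines the cell dimension exist.
\<close>

lemma contains_cell_le_DIM:
  fixes A :: "'a::euclidean_space set"
  assumes "contains_cell A d"
  shows "d \<le> DIM('a)"
proof -
  have "interior ((\<lambda>x::'a. (x, 0::real)) ` A) \<subseteq> interior (UNIV \<times> {0})"
    by (intro interior_mono) auto
  then have "d < DIM('a \<times> real)"
    using assms
    by (intro contains_cell_less_DIM[where g = "\<lambda>x. (x, 0)"])
       (auto simp: inj_on_def interior_Times intro!: continuous_intros)
  then show ?thesis by simp
qed

lemma contains_cell_le_cell_dim: "contains_cell A d \<Longrightarrow> d \<le> cell_dim A"
  unfolding cell_dim_def using contains_cell_le_DIM by (intro Greatest_le_nat) auto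

lemma cell_dim_less_DIM:
  fixes g :: "'a::euclidean_space \<Rightarrow> 'b::euclidean_space"
  assumes "A \<noteq> {}" "continuous_on A g" "inj_on g A" "interior (g ` A) = {}"
  shows "cell_dim A < DIM('b)"
proof -
  have "contains_cell A (cell_dim A)"
    unfolding cell_dim_def
    using assms(1) contains_cell_0 contains_cell_le_DIM
    by (metis (no_types, lifting) GreatestI_nat ex_in_conv)
  then show ?thesis
    using assms contains_cell_less_DIM by blast
qed

text \<open>
  A continuous injection is a homeomorphism onto its image on a closed ball, by compactness, and
  hence on the open ball, which is a copy of the whole space.
\<close>

lemma contains_cell_injective_image:
  fixes f :: "'c::euclidean_space \<Rightarrow> 'a::euclidean_space"
  assumes "open V" "V \<noteq> {}" "continuous_on V f" "inj_on f V" "f ` V \<subseteq> A"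
  shows "contains_cell A DIM('c)"
proof -
  obtain x e where e: "e > 0" "cball x e \<subseteq> V"
    using assms(1,2) open_contains_cball by blast
  obtain g where "homeomorphism (cball x e) (f ` cball x e) f g"
    using homeomorphism_compact[of "cball x e" f] assms(3,4) e
    by (meson compact_cball continuous_on_subset inj_on_subset)
  then have "homeomorphism (ball x e) (f ` ball x e) f g"
    by (rule homeomorphism_of_subsets) auto
  then have "f ` ball x e homeomorphic ball x e"
    by (meson homeomorphic_def homeomorphic_sym)
  also have "ball x e homeomorphic (UNIV :: 'c set)"
    using e by (simp add: homeomorphic_ball_UNIV)
  finally have "f ` ball x e homeomorphic (UNIV :: 'c set)" .
  moreover have "f ` ball x e \<subseteq> A"
    using e assms(5) ball_subset_cball by blast
  ultimately show ?thesis
    unfolding contains_cell_DIM_iff by blast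
qed

lemma local_dim_le_cell_dim: "open U \<Longrightarrow> x \<in> U \<Longrightarrow> local_dim A x \<le> cell_dim (A \<inter> U)"
  unfolding local_dim_def by (rule cINF_lower) auto

lemma local_dim_eqI:
  assumes "\<And>U. open U \<Longrightarrow> x \<in> U \<Longrightarrow> cell_dim (A \<inter> U) = d"
  shows "local_dim A x = d"
proof -
  have "UNIV \<in> {U. open U \<and> x \<in> U}" by simp
  then have "(\<lambda>U. cell_dim (A \<inter> U)) ` {U. open U \<and> x \<in> U} = {d}"
    using assms by blast
  then show ?thesis by (simp add: local_dim_def)
qed

section \<open>The zero locus\<close>

lemma disc_point_nth [simp]:
  "disc_point \<sigma> a b c $ 1 = a" "disc_point \<sigma> a b c $ 2 = b"
  "disc_point \<sigma> a b c $ 3 = \<sigma> * sqrt (1 - (a\<^sup>2 + b\<^sup>2 + c\<^sup>2))" "disc_point \<sigma> a b c $ 4 = c"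
  by (simp_all add: disc_point_def vector_def)

text \<open>
  The three disc coordinates determine the point; this is why the zero locus can be studied in
  three-dimensional space.
\<close>

lemma disc_point_coordinates: "\<nu> \<in> disc \<sigma> \<Longrightarrow> \<nu> = disc_point \<sigma> (\<nu>$1) (\<nu>$2) (\<nu>$4)"
  by (simp add: vec_eq_iff forall_4 disc_def)

lemma disc_point_in_zero_locus_iff:
  "disc_point \<sigma> a b c \<in> zero_locus \<sigma> \<longleftrightarrow>
     a\<^sup>2 + b\<^sup>2 + c\<^sup>2 \<le> 1 \<and> a\<^sup>2 * (1 - 2 * b\<^sup>2) = b\<^sup>2 * c\<^sup>2"
  by (auto simp: zero_locus_def disc_def G_def algebra_simps)

lemma phi_nth:
  "phi \<sigma> (s, t) $ 1 = 1/2 * sqrt 2 * s * cos t" "phi \<sigma> (s, t) $ 2 = 1/2 * sqrt 2 * cos t"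
  "phi \<sigma> (s, t) $ 4 = s * sin t"
  by (simp_all add: phi_def)

lemma phi_in_zero_locus:
  assumes "s \<in> {-1..1}"
  shows "phi \<sigma> (s, t) \<in> zero_locus \<sigma>" and "2 * (phi \<sigma> (s, t) $ 2)\<^sup>2 \<le> 1"
proof -
  have "s\<^sup>2 \<le> 1" using assms by (auto simp: abs_square_le_1 abs_le_iff)
  have c: "(cos t)\<^sup>2 \<le> 1" by (simp add: abs_square_le_1)
  \<comment> \<open>Half of this product is 1 minus the squared norm of the disc coordinates.\<close>
  have "(1 - s\<^sup>2) * (2 - (cos t)\<^sup>2) \<ge> 0"
    using \<open>s\<^sup>2 \<le> 1\<close> c by (intro mult_nonneg_nonneg) auto
  then have "(1/2 * sqrt 2 * s * cos t)\<^sup>2 + (1/2 * sqrt 2 * cos t)\<^sup>2 + (s * sin t)\<^sup>2 \<le> 1"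
    by (simp add: power_mult_distrib power_divide sin_squared_eq algebra_simps)
  moreover have "(1/2 * sqrt 2 * s * cos t)\<^sup>2 * (1 - 2 * (1/2 * sqrt 2 * cos t)\<^sup>2) =
      (1/2 * sqrt 2 * cos t)\<^sup>2 * (s * sin t)\<^sup>2"
    by (simp add: power_mult_distrib power_divide sin_squared_eq field_simps)
  ultimately show "phi \<sigma> (s, t) \<in> zero_locus \<sigma>"
    by (simp add: phi_def disc_point_in_zero_locus_iff)
  show "2 * (phi \<sigma> (s, t) $ 2)\<^sup>2 \<le> 1"
    using c by (simp add: phi_nth power_mult_distrib power_divide)
qed

lemma zero_locus_in_phi_image:
  assumes "\<nu> \<in> zero_locus \<sigma>" "2 * (\<nu>$2)\<^sup>2 \<le> 1"
  shows "\<nu> \<in> phi \<sigma> ` rectangle"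
proof -
  define a b c where "a = \<nu>$1" and "b = \<nu>$2" and "c = \<nu>$4"
  have \<nu>: "\<nu> = disc_point \<sigma> a b c"
    unfolding a_def b_def c_def using assms(1) by (intro disc_point_coordinates) (simp add: zero_locus_def)
  have n: "a\<^sup>2 + b\<^sup>2 + c\<^sup>2 \<le> 1" and eq: "a\<^sup>2 * (1 - 2 * b\<^sup>2) = b\<^sup>2 * c\<^sup>2" and b: "2 * b\<^sup>2 \<le> 1"
    using assms unfolding \<nu> disc_point_in_zero_locus_iff by auto
  have "\<bar>sqrt 2 * b\<bar> \<le> 1"
    using b by (simp add: abs_square_le_1[symmetric] power_mult_distrib)
  then have bc: "cos (arccos (sqrt 2 * b)) = sqrt 2 * b" and ar: "0 \<le> arccos (sqrt 2 * b)" "arccos (sqrt 2 * b) \<le> pi"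
    by (auto simp: abs_le_iff intro!: cos_arccos arccos_lbound arccos_ubound)
  \<comment> \<open>The arc cosine fixes the angle only up to reflection; the reflection is chosen to match signs.\<close>
  obtain t where t: "0 \<le> t" "t \<le> 2 * pi" "cos t = sqrt 2 * b" and sgn: "a * sin t = b * c"
  proof -
    let ?t = "arccos (sqrt 2 * b)"
    have "(sin ?t)\<^sup>2 = 1 - 2 * b\<^sup>2"
      by (simp add: sin_squared_eq bc power_mult_distrib)
    then have "(a * sin ?t)\<^sup>2 = (b * c)\<^sup>2"
      using eq by (simp add: power_mult_distrib)
    then consider "a * sin ?t = b * c" | "a * sin (2 * pi - ?t) = b * c"
      by (auto simp: power2_eq_iff sin_diff)
    then show thesis
    proof cases
      case 1
      then show ?thesis using that[of ?t] ar bc by auto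
    next
      case 2
      then show ?thesis using that[of "2 * pi - ?t"] ar bc by (auto simp: cos_diff)
    qed
  qed
  \<comment> \<open>By \<open>sgn\<close>, the vector \<open>(a, c)\<close> is parallel to \<open>(b, sin t)\<close>, which is nonzero.\<close>
  obtain s where s: "a = s * b" "c = s * sin t"
  proof (cases "b = 0")
    case True
    then have "a = 0" and "sin t \<noteq> 0"
      using eq t sin_cos_squared_add[of t] by auto
    then show ?thesis using that[of "c / sin t"] True by auto
  next
    case False
    then show ?thesis using that[of "a / b"] sgn by (auto simp: field_simps)
  qed
  have s2: "(sin t)\<^sup>2 = 1 - 2 * b\<^sup>2"
    by (simp add: sin_squared_eq t power_mult_distrib)
  have "s\<^sup>2 * (1 - b\<^sup>2) \<le> 1 - b\<^sup>2"
    using n unfolding s power_mult_distrib s2 by (simp add: algebra_simps)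
  moreover have "1 - b\<^sup>2 > 0" using b zero_le_power2[of b] by linarith
  ultimately have "s\<^sup>2 \<le> 1" by simp
  then have "(s, t) \<in> rectangle"
    using t by (auto simp: rectangle_def abs_square_le_1 abs_le_iff)
  moreover have sqrt2: "sqrt 2 * (sqrt 2 * x) = 2 * x" for x
    by (simp flip: mult.assoc)
  have "phi \<sigma> (s, t) = \<nu>"
    by (simp add: phi_def \<nu> t s mult.assoc mult.left_commute sqrt2)
  ultimately show ?thesis by force
qed

lemma phi_image_eq: "phi \<sigma> ` rectangle = {\<nu> \<in> zero_locus \<sigma>. 2 * (\<nu>$2)\<^sup>2 \<le> 1}"
  using phi_in_zero_locus zero_locus_in_phi_image by (auto simp: rectangle_def)

lemma zero_locus_whisker:
  assumes "\<nu> \<in> zero_locus \<sigma>" "2 * (\<nu>$2)\<^sup>2 > 1"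
  shows "\<nu> = disc_point \<sigma> 0 (\<nu>$2) 0"
proof -
  have \<nu>: "\<nu> = disc_point \<sigma> (\<nu>$1) (\<nu>$2) (\<nu>$4)"
    using assms(1) by (intro disc_point_coordinates) (simp add: zero_locus_def)
  then have "(\<nu>$1)\<^sup>2 * (1 - 2 * (\<nu>$2)\<^sup>2) = (\<nu>$2)\<^sup>2 * (\<nu>$4)\<^sup>2"
    using assms(1) disc_point_in_zero_locus_iff by metis
  moreover have "(\<nu>$1)\<^sup>2 * (1 - 2 * (\<nu>$2)\<^sup>2) \<le> 0"
    using assms(2) by (intro mult_nonneg_nonpos) auto
  ultimately have "(\<nu>$2)\<^sup>2 * (\<nu>$4)\<^sup>2 = 0" "(\<nu>$1)\<^sup>2 * (1 - 2 * (\<nu>$2)\<^sup>2) = 0"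
    by (metis mult_nonneg_nonneg order_antisym zero_le_power2)+
  then have "\<nu>$4 = 0" "\<nu>$1 = 0"
    using assms(2) by auto
  with \<nu> show ?thesis by simp
qed

section \<open>Coincidences of the parametrisation\<close>

lemma phi_eq_iff:
  "phi \<sigma> (s, t) = phi \<sigma> (s', t') \<longleftrightarrow>
     cos t = cos t' \<and> s * cos t = s' * cos t' \<and> s * sin t = s' * sin t'"
proof
  assume "phi \<sigma> (s, t) = phi \<sigma> (s', t')"
  from arg_cong[OF this, of "\<lambda>\<nu>. \<nu>$1"] arg_cong[OF this, of "\<lambda>\<nu>. \<nu>$2"]
    arg_cong[OF this, of "\<lambda>\<nu>. \<nu>$4"]
  show "cos t = cos t' \<and> s * cos t = s' * cos t' \<and> s * sin t = s' * sin t'"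
    by (simp add: phi_nth)
qed (auto simp: phi_def mult.assoc)

lemma cos_three_halves_pi: "cos (3*pi/2) = 0" and sin_three_halves_pi: "sin (3*pi/2) = -1"
  using cos_3over2_pi sin_3over2_pi by (simp_all add: mult.commute)

lemma phi_periodic: "phi \<sigma> (s, 0) = phi \<sigma> (s, 2*pi)"
  and phi_quarter_symmetry: "phi \<sigma> (s, pi/2) = phi \<sigma> (-s, 3*pi/2)"
  and phi_axis_symmetry: "phi \<sigma> (0, t) = phi \<sigma> (0, 2*pi - t)"
  by (simp_all add: phi_eq_iff cos_three_halves_pi sin_three_halves_pi cos_diff)

lemma cos_eq_on_period:
  assumes "t \<in> {0..2*pi}" "t' \<in> {0..2*pi}" "cos t = cos t'"
  shows "t' = t \<or> t' = 2 * pi - t"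
proof -
  \<comment> \<open>Fold the period onto \<open>[0, \<pi>]\<close>, where the cosine is injective.\<close>
  define u where "u = (\<lambda>t. if t \<le> pi then t else 2 * pi - t)"
  have "cos (u t) = cos (u t')"
    using assms(3) by (simp add: u_def cos_diff)
  moreover have "0 \<le> u x \<and> u x \<le> pi" if "x \<in> {0..2*pi}" for x
    using that by (simp add: u_def)
  ultimately have "u t = u t'"
    using assms(1,2) cos_inj_pi by blast
  then show ?thesis
    by (auto simp: u_def split: if_splits)
qed

text \<open>
  Equal second coordinates leave \<open>t' = t\<close> or \<open>t' = 2 \<pi> - t\<close>. If \<open>cos t \<noteq> 0\<close>, the first coordinate
  gives \<open>s' = s\<close>, and for \<open>s \<noteq> 0\<close> the reflected angle survives only if \<open>sin t = 0\<close>, which is the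
  glued pair of end points or the fixed angle \<open>\<pi>\<close>. If \<open>cos t = 0\<close>, the first coordinate is void
  and only \<open>s' sin t' = s sin t\<close> is left. If \<open>s = 0\<close>, then \<open>s' = 0\<close>, as sine and cosine have no
  common zero, and both angles occur.
\<close>

lemma phi_eq_imp:
  assumes "(s, t) \<in> rectangle" "(s', t') \<in> rectangle" "phi \<sigma> (s', t') = phi \<sigma> (s, t)"
  shows phi_eq_imp_glue: "s \<noteq> 0 \<Longrightarrow> t \<noteq> pi/2 \<Longrightarrow> t \<noteq> 3*pi/2 \<Longrightarrow> ((s, t), (s', t')) \<in> glue"
    and phi_eq_imp_quarter: "t = pi/2 \<Longrightarrow> (s', t') = (s, pi/2) \<or> (s', t') = (-s, 3*pi/2)"
    and phi_eq_imp_axis: "s = 0 \<Longrightarrow> (s', t') = (0, t) \<or> (s', t') = (0, 2*pi - t)"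
proof -
  have t: "t \<in> {0..2*pi}" "t' \<in> {0..2*pi}"
    using assms by (auto simp: rectangle_def)
  have eqs: "cos t' = cos t" "s' * cos t' = s * cos t" "s' * sin t' = s * sin t"
    using assms(3) by (auto simp: phi_eq_iff)
  have t': "t' = t \<or> t' = 2 * pi - t"
    using cos_eq_on_period t eqs by simp
  have "sin t' \<noteq> 0 \<or> cos t' \<noteq> 0"
    by (metis add_0 power_zero_numeral sin_cos_squared_add zero_neq_one)
  then show "s = 0 \<Longrightarrow> (s', t') = (0, t) \<or> (s', t') = (0, 2*pi - t)"
    using t' eqs by auto
  show "t = pi/2 \<Longrightarrow> (s', t') = (s, pi/2) \<or> (s', t') = (-s, 3*pi/2)"
  proof -
    assume t: "t = pi/2"
    then consider "t' = pi/2" | "t' = 3*pi/2"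
      using t' by force
    then show ?thesis
    proof cases
      case 1
      then show ?thesis using eqs(3)[unfolded t 1] by simp
    next
      case 2
      then show ?thesis using eqs(3)[unfolded t 2] sin_three_halves_pi by simp
    qed
  qed
  assume s: "s \<noteq> 0" and "t \<noteq> pi/2" "t \<noteq> 3*pi/2"
  moreover have "cos (pi/2) = 0" by simp
  ultimately have "cos t \<noteq> 0"
    using cos_eq_on_period[of "pi/2" t] t by (auto simp: field_simps)
  then have "s' = s" using eqs by auto
  moreover have "t' = t \<or> {t, t'} = {0, 2*pi}"
  proof (cases "t' = t")
    case False
    with t' have "t' = 2 * pi - t" by simp
    then have "sin t = 0" using eqs(3) s \<open>s' = s\<close> by (auto simp: sin_diff)
    then have "t = 0 \<or> t = pi \<or> t = 2 * pi"
      using t sin_gt_zero[of t] sin_lt_zero[of t] by (smt (verit) atLeastAtMost_iff)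
    then have "t = 0 \<and> t' = 2 * pi \<or> t = 2 * pi \<and> t' = 0"
      using \<open>t' = 2 * pi - t\<close> False by linarith
    then show ?thesis unfolding doubleton_eq_iff by blast
  qed simp
  ultimately show "((s, t), (s', t')) \<in> glue"
    using assms(1,2) by (simp add: glue_def eq_commute[of t])
qed

lemma equiv_glue: "equiv rectangle glue"
  by (rule equivI) (auto simp: glue_def refl_on_def sym_def trans_def doubleton_eq_iff)

lemma phi_glue: "(p, q) \<in> glue \<Longrightarrow> phi \<sigma> p = phi \<sigma> q"
  by (auto simp: glue_def phi_def doubleton_eq_iff)

text \<open>
  Reduces fibres of the induced map on the quotient to fibres on the rectangle, since \<open>phi\<close> is
  constant on each class.
\<close>

lemma fibre_phi:
  assumes "p \<in> rectangle"
  shows "fibre \<sigma> (phi \<sigma> p) = cls ` {q \<in> rectangle. phi \<sigma> q = phi \<sigma> p}"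
proof -
  have "phi \<sigma> ` cls q = {phi \<sigma> q}" if "q \<in> rectangle" for q
  proof -
    have "phi \<sigma> r = phi \<sigma> q" if "r \<in> cls q" for r
      using that phi_glue[of q r \<sigma>] by simp
    then show ?thesis
      using equiv_class_self[OF equiv_glue that] by blast
  qed
  then have "{q \<in> rectangle. phi \<sigma> ` cls q = {phi \<sigma> p}} = {q \<in> rectangle. phi \<sigma> q = phi \<sigma> p}"
    by (metis (lifting) singleton_inject)
  moreover have "fibre \<sigma> (phi \<sigma> p) = cls ` {q \<in> rectangle. phi \<sigma> ` cls q = {phi \<sigma> p}}"
    unfolding fibre_def quotient_def by blast
  ultimately show ?thesis by simp
qed

lemma fibre_generic:
  assumes "s \<in> {-1..1}" "t \<in> {0..2*pi}" "s \<noteq> 0" "t \<noteq> pi/2" "t \<noteq> 3*pi/2"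
  shows "fibre \<sigma> (phi \<sigma> (s, t)) = {cls (s, t)}"
proof -
  have p: "(s, t) \<in> rectangle" using assms by (simp add: rectangle_def)
  have "cls q = cls (s, t)" if "q \<in> rectangle" "phi \<sigma> q = phi \<sigma> (s, t)" for q
  proof -
    obtain s' t' where q: "q = (s', t')" by fastforce
    have "((s, t), q) \<in> glue"
      using phi_eq_imp_glue[OF p] that assms(3-5) unfolding q by blast
    then show ?thesis
      by (rule equiv_class_eq[OF equiv_glue, symmetric])
  qed
  then have "fibre \<sigma> (phi \<sigma> (s, t)) \<subseteq> {cls (s, t)}"
    unfolding fibre_phi[OF p] by blast
  moreover have "cls (s, t) \<in> fibre \<sigma> (phi \<sigma> (s, t))"
    unfolding fibre_phi[OF p] by (rule imageI) (simp add: p)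
  ultimately show ?thesis by blast
qed

lemma fibre_quarter:
  assumes "s \<in> {-1..1}"
  shows "fibre \<sigma> (phi \<sigma> (s, pi/2)) = {cls (s, pi/2), cls (-s, 3*pi/2)}"
    and "card (fibre \<sigma> (phi \<sigma> (s, pi/2))) = 2"
proof -
  have p: "(s, pi/2) \<in> rectangle" "(-s, 3*pi/2) \<in> rectangle"
    using assms by (auto simp: rectangle_def)
  have "{q \<in> rectangle. phi \<sigma> q = phi \<sigma> (s, pi/2)} = {(s, pi/2), (-s, 3*pi/2)}"
  proof (intro equalityI subsetI)
    fix q :: "real \<times> real" assume "q \<in> {q \<in> rectangle. phi \<sigma> q = phi \<sigma> (s, pi/2)}"
    then show "q \<in> {(s, pi/2), (-s, 3*pi/2)}"
      using phi_eq_imp_quarter[OF p(1), of "fst q" "snd q" \<sigma>] by simp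
  next
    fix q :: "real \<times> real" assume "q \<in> {(s, pi/2), (-s, 3*pi/2)}"
    then show "q \<in> {q \<in> rectangle. phi \<sigma> q = phi \<sigma> (s, pi/2)}"
      using p phi_quarter_symmetry[of \<sigma> s] by (elim insertE) (simp_all only: mem_Collect_eq empty_iff)
  qed
  then show eq: "fibre \<sigma> (phi \<sigma> (s, pi/2)) = {cls (s, pi/2), cls (-s, 3*pi/2)}"
    by (simp add: fibre_phi[OF p(1)])
  have "cls (s, pi/2) \<noteq> cls (-s, 3*pi/2)"
    unfolding eq_equiv_class_iff[OF equiv_glue p]
    by (auto simp: glue_def doubleton_eq_iff)
  then show "card (fibre \<sigma> (phi \<sigma> (s, pi/2))) = 2"
    by (simp add: eq)
qed

lemma fibre_axis:
  assumes "t \<in> {0..2*pi}"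
  shows "fibre \<sigma> (phi \<sigma> (0, t)) = {cls (0, t), cls (0, 2*pi - t)}"
    and "card (fibre \<sigma> (phi \<sigma> (0, t))) = (if t \<in> {0, pi, 2*pi} then 1 else 2)"
proof -
  have p: "(0, t) \<in> rectangle" "(0, 2*pi - t) \<in> rectangle"
    using assms by (auto simp: rectangle_def)
  have "{q \<in> rectangle. phi \<sigma> q = phi \<sigma> (0, t)} = {(0, t), (0, 2*pi - t)}"
  proof (intro equalityI subsetI)
    fix q :: "real \<times> real" assume "q \<in> {q \<in> rectangle. phi \<sigma> q = phi \<sigma> (0, t)}"
    then show "q \<in> {(0, t), (0, 2*pi - t)}"
      using phi_eq_imp_axis[OF p(1), of "fst q" "snd q" \<sigma>] by simp
  next
    fix q :: "real \<times> real" assume "q \<in> {(0, t), (0, 2*pi - t)}"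
    then show "q \<in> {q \<in> rectangle. phi \<sigma> q = phi \<sigma> (0, t)}"
      using p phi_axis_symmetry[of \<sigma> t] by (elim insertE) (simp_all only: mem_Collect_eq empty_iff)
  qed
  then show eq: "fibre \<sigma> (phi \<sigma> (0, t)) = {cls (0, t), cls (0, 2*pi - t)}"
    by (simp add: fibre_phi[OF p(1)])
  have "cls (0, t) = cls (0, 2*pi - t) \<longleftrightarrow> t \<in> {0, pi, 2*pi}"
    unfolding eq_equiv_class_iff[OF equiv_glue p]
    using p by (auto simp: glue_def doubleton_eq_iff)
  then show "card (fibre \<sigma> (phi \<sigma> (0, t))) = (if t \<in> {0, pi, 2*pi} then 1 else 2)"
    by (simp add: eq card_insert_if)
qed

section \<open>The surfaces as images of the parametrisation\<close>

lemma continuous_on_phi: "continuous_on S (phi \<sigma>)"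
proof -
  have "\<forall>i. continuous_on S (\<lambda>p. phi \<sigma> p $ i)"
    unfolding forall_4 phi_def case_prod_unfold disc_point_nth
    by (intro conjI continuous_intros)
  then have "continuous_on S (\<lambda>p. \<chi> i. phi \<sigma> p $ i)"
    by (intro continuous_on_vec_lambda) auto
  then show ?thesis by simp
qed

text \<open>
  Near \<open>p\<close> there is an open subset of the rectangle on which \<open>phi\<close> is injective and takes values
  in \<open>U\<close>.
\<close>

lemma phi_image_contains_2_cell:
  assumes "p \<in> rectangle" "open U" "phi \<sigma> p \<in> U"
  shows "contains_cell (phi \<sigma> ` rectangle \<inter> U) 2"
proof -
  \<comment> \<open>The interior of the rectangle without the lines on which injectivity fails.\<close>
  define D :: "(real \<times> real) set" where
    "D = ({-1<..<0} \<union> {0<..<1}) \<times> ({0<..<pi/2} \<union> {pi/2<..<3*pi/2} \<union> {3*pi/2<..<2*pi})"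
  have "closure D = rectangle"
    by (auto simp: D_def rectangle_def closure_Times)
  have "open D" and D: "D \<subseteq> rectangle"
    by (auto simp: D_def rectangle_def intro!: open_Times open_Un)
  have "inj_on (phi \<sigma>) D"
  proof (rule inj_onI)
    fix q r assume qr: "q \<in> D" "r \<in> D" "phi \<sigma> q = phi \<sigma> r"
    obtain s t s' t' where st: "q = (s, t)" "r = (s', t')" by fastforce
    have "(q, r) \<in> glue"
      unfolding st using qr D by (intro phi_eq_imp_glue[where \<sigma>=\<sigma>]) (auto simp: st D_def)
    then show "q = r"
      using qr by (auto simp: st glue_def D_def doubleton_eq_iff)
  qed
  moreover have "open (phi \<sigma> -` U)"
    using assms(2) continuous_on_phi by (rule open_vimage)
  moreover from this have "phi \<sigma> -` U \<inter> D \<noteq> {}"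
    using assms \<open>closure D = rectangle\<close> open_Int_closure_eq_empty[of "phi \<sigma> -` U" D] by auto
  ultimately have "contains_cell (phi \<sigma> ` rectangle \<inter> U) DIM(real \<times> real)"
    using D \<open>open D\<close> continuous_on_phi
    by (intro contains_cell_injective_image[of "phi \<sigma> -` U \<inter> D" "phi \<sigma>"]) (auto intro: inj_on_subset)
  then show ?thesis by (simp add: numeral_2_eq_2)
qed

text \<open>
  Unless \<open>2 b\<^sup>2 = 1\<close>, the equation has at most two solutions \<open>a\<close> for given \<open>b\<close> and \<open>c\<close>. An interior
  point could be moved in the \<open>b\<close>-direction off the exceptional values, and would then have an
  interval of solutions \<open>a\<close>.
\<close>

lemma interior_zero_set:
  "interior {(a::real, b::real, c::real). a\<^sup>2 * (1 - 2 * b\<^sup>2) = b\<^sup>2 * c\<^sup>2} = {}" (is "interior ?Z = {}")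
proof (rule ccontr)
  assume "interior ?Z \<noteq> {}"
  then obtain a b c where abc: "(a, b, c) \<in> interior ?Z" by fastforce
  define B where "B = (\<lambda>b'. (a, b', c)) -` interior ?Z"
  have "open B"
    unfolding B_def by (intro open_vimage continuous_intros) auto
  moreover have "b \<in> B" using abc by (simp add: B_def)
  ultimately have "infinite B"
    using finite_imp_not_open by blast
  then obtain b' where b': "b' \<in> B" "b' \<notin> {1 / sqrt 2, - 1 / sqrt 2}"
    by (meson finite.emptyI finite.insertI finite_subset subsetI)
  then have nz: "1 - 2 * b'\<^sup>2 \<noteq> 0"
    by (auto simp: field_simps power2_eq_iff[symmetric] power_mult_distrib real_sqrt_pow2_iff dest!: arg_cong[where f=sqrt])
  define d where "d = b'\<^sup>2 * c\<^sup>2 / (1 - 2 * b'\<^sup>2)"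
  define A where "A = (\<lambda>a'. (a', b', c)) -` interior ?Z"
  have "open A"
    unfolding A_def by (intro open_vimage continuous_intros) auto
  moreover have "a \<in> A" using b' by (simp add: A_def B_def)
  ultimately have "infinite A"
    using finite_imp_not_open by blast
  moreover have "A \<subseteq> {sqrt d, - sqrt d}"
  proof
    fix x assume "x \<in> A"
    then have "x\<^sup>2 * (1 - 2 * b'\<^sup>2) = b'\<^sup>2 * c\<^sup>2"
      using interior_subset[of ?Z] by (auto simp: A_def)
    then have "x\<^sup>2 = d" using nz by (simp add: d_def field_simps)
    then show "x \<in> {sqrt d, - sqrt d}" by (auto simp: abs_if split: if_splits)
  qed
  ultimately show False using finite_subset by blast
qed

lemma cell_dim_zero_locus_le_2:
  assumes "A \<subseteq> zero_locus \<sigma>" "A \<noteq> {}"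
  shows "cell_dim A \<le> 2"
proof -
  let ?g = "\<lambda>\<nu>::real^4. (\<nu>$1, \<nu>$2, \<nu>$4)"
  have "inj_on ?g A"
    by (rule inj_onI) (metis (mono_tags, lifting) assms(1) disc_point_coordinates mem_Collect_eq prod.inject subsetD zero_locus_def)
  moreover have "?g ` A \<subseteq> {(a, b, c). a\<^sup>2 * (1 - 2 * b\<^sup>2) = b\<^sup>2 * c\<^sup>2}"
    using assms(1) by (auto simp: zero_locus_def G_def algebra_simps)
  then have "interior (?g ` A) = {}"
    using interior_mono interior_zero_set by blast
  ultimately have "cell_dim A < DIM(real \<times> real \<times> real)"
    using assms(2) by (intro cell_dim_less_DIM[where g = ?g] continuous_intros)
  then show ?thesis by simp
qed

lemma local_dim_phi:
  assumes "p \<in> rectangle"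
  shows "local_dim (zero_locus \<sigma>) (phi \<sigma> p) = 2"
proof (rule local_dim_eqI)
  fix U assume U: "open U" "phi \<sigma> p \<in> U"
  have "contains_cell (zero_locus \<sigma> \<inter> U) 2"
    using phi_image_contains_2_cell[OF assms U] unfolding contains_cell_def phi_image_eq by blast
  moreover have "phi \<sigma> p \<in> zero_locus \<sigma>"
    using assms phi_image_eq by blast
  ultimately show "cell_dim (zero_locus \<sigma> \<inter> U) = 2"
    using contains_cell_le_cell_dim cell_dim_zero_locus_le_2[of "zero_locus \<sigma> \<inter> U" \<sigma>] U
    by (metis IntI empty_iff inf_le1 order_antisym)
qed

text \<open>
  The condition on the second coordinate is open, so near \<open>\<nu>\<close> the zero locus lies on the whisker. That
  coordinate alone is injective there, and maps it into a line in the plane.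
\<close>

lemma local_dim_whisker:
  assumes "\<nu> \<in> zero_locus \<sigma>" "2 * (\<nu>$2)\<^sup>2 > 1"
  shows "local_dim (zero_locus \<sigma>) \<nu> < 2"
proof -
  define U where "U = {\<nu>::real^4. 2 * (\<nu>$2)\<^sup>2 > 1}"
  let ?A = "zero_locus \<sigma> \<inter> U" and ?g = "\<lambda>\<nu>::real^4. (\<nu>$2, 0::real)"
  have "open U"
    unfolding U_def by (intro open_Collect_less continuous_intros)
  have "inj_on ?g ?A"
    using zero_locus_whisker by (intro inj_onI) (metis (mono_tags, lifting) IntE U_def mem_Collect_eq prod.inject)
  moreover have "interior (?g ` ?A) \<subseteq> interior (UNIV \<times> {0})"
    by (intro interior_mono) auto
  then have "interior (?g ` ?A) = {}"
    by (simp add: interior_Times)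
  moreover have "\<nu> \<in> ?A" using assms by (simp add: U_def)
  ultimately have "cell_dim ?A < DIM(real \<times> real)"
    by (intro cell_dim_less_DIM[where g = ?g] continuous_intros) auto
  moreover have "local_dim (zero_locus \<sigma>) \<nu> \<le> cell_dim ?A"
    using \<open>open U\<close> \<open>\<nu> \<in> ?A\<close> by (intro local_dim_le_cell_dim) auto
  ultimately show ?thesis by simp
qed

lemma surface_eq_phi_image: "surface \<sigma> = phi \<sigma> ` rectangle"
proof -
  have "local_dim (zero_locus \<sigma>) \<nu> = 2 \<longleftrightarrow> 2 * (\<nu>$2)\<^sup>2 \<le> 1" if "\<nu> \<in> zero_locus \<sigma>" for \<nu>
  proof (cases "2 * (\<nu>$2)\<^sup>2 \<le> 1")
    case True
    then show ?thesis using zero_locus_in_phi_image[OF that] local_dim_phi by auto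
  next
    case False
    then show ?thesis using local_dim_whisker[OF that] by simp
  qed
  then show ?thesis
    unfolding surface_def phi_image_eq by auto
qed

lemma surface_distinct: "surface 1 \<noteq> surface (-1)"
proof -
  have "phi 1 (0, pi/2) \<in> surface 1"
    unfolding surface_eq_phi_image by (auto simp: rectangle_def)
  \<comment> \<open>This is the pole with third coordinate 1.\<close>
  moreover have "phi 1 (0, pi/2) \<notin> surface (-1)"
    by (simp add: surface_def zero_locus_def disc_def phi_def)
  ultimately show ?thesis by blast
qed

theorem proposition5p5:
  shows "critical_surface = surface 1 \<union> surface (-1) \<and> surface 1 \<noteq> surface (-1) \<and>
    (\<forall>\<sigma>\<in>{1, -1}.
      surface \<sigma> = phi \<sigma> ` rectangle \<and>
      (\<forall>s\<in>{-1..1}. phi \<sigma> (s, 0) = phi \<sigma> (s, 2*pi)) \<and>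
      (\<forall>s\<in>{-1..1}. phi \<sigma> (s, pi/2) = phi \<sigma> (-s, 3*pi/2)) \<and>
      (\<forall>t\<in>{0..2*pi}. phi \<sigma> (0, t) = phi \<sigma> (0, 2*pi - t)) \<and>
      (\<forall>s\<in>{-1..1}. \<forall>t\<in>{0..2*pi}. s \<noteq> 0 \<and> t \<noteq> pi/2 \<and> t \<noteq> 3*pi/2 \<longrightarrow>
         fibre \<sigma> (phi \<sigma> (s, t)) = {cls (s, t)}) \<and>
      (\<forall>s\<in>{-1..1}. fibre \<sigma> (phi \<sigma> (s, pi/2)) = {cls (s, pi/2), cls (-s, 3*pi/2)} \<and>
         card (fibre \<sigma> (phi \<sigma> (s, pi/2))) = 2) \<and>
      (\<forall>t\<in>{0..2*pi}. fibre \<sigma> (phi \<sigma> (0, t)) = {cls (0, t), cls (0, 2*pi - t)} \<and>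
         card (fibre \<sigma> (phi \<sigma> (0, t))) = (if t \<in> {0, pi, 2*pi} then 1 else 2)))"
  by (intro conjI ballI impI critical_surface_def surface_distinct surface_eq_phi_image
      phi_periodic phi_quarter_symmetry phi_axis_symmetry fibre_generic fibre_quarter fibre_axis)
    simp_all

end
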